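(* Let $\mathcal{R}=\{r_1,\ldots,r_{|\mathcal{R}|}\}$ be a finite ordered set of (pairwise distinct) requests, and let $\hat{\mathcal{T}}$ be the set of all feasible trips, i.e. of all nonempty subsets of $\mathcal{R}$ that are feasible (in the sense defined in the context). For each integer $l\ge 1$ let $\mathcal{T}(l)=\{p\in\hat{\mathcal{T}}: |p|=l\}$ be the set of feasible trips consisting of exactly $l$ requests. For each $p\in\mathcal{T}(l)$ let $j_p^*=\max\{j: 1\le j\le |\mathcal{R}|,\ r_j\in p\}$ be the highest request index in $p$. Then for every $l\ge 1$, $$\mathcal{T}(l+1)=\left(\bigcup_{p\in\mathcal{T}(l)}\big\{p\cup\{r_j\}:\ j_p^*+1\le j\le |\mathcal{R}|\big\}\right)\cap\hat{\mathcal{T}}.$$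
   Context: Road network and travel times. Locations are nodes of a finite road network with positive arc lengths in which every node is reachable from every other. $\mathrm{TD}(a,b)$ is the length of a shortest path from $a$ to $b$ (so $\mathrm{TD}(a,a)=0$), the vehicle speed is a constant $v>0$, and $\mathrm{TT}(a,b)=\mathrm{TD}(a,b)/v$. Requests. The finite request set is $\mathcal{R}=\mathcal{R}_P\cup\mathcal{R}_F$ (disjoint union of passenger and parcel requests). Each request $r$ has an origin $o_r$, a destination $d_r\neq o_r$, a submission time $t_r^s\ge 0$, a nonnegative load, and an earliest possible arrival time $t_r^*=t_r^s+\mathrm{TT}(o_r,d_r)$. Fixed parameters: vehicle capacity $Q\geq 0$; maximum wait time $\sigma\ge0$; maximum delays $\Delta_P\ge 0$ (passengers) and $\Delta_F\ge 0$ (parcels); maximum number $\eta\ge 0$ of intermediate stops during one passenger service; passenger loads are such that $Q$ is less than twice the load of any passenger request. Feasibility of a set of requests. Let $\mathcal{R}^*\subseteq\mathcal{R}$ be nonempty with $n$ passenger requests and $m$ parcel requests, and $\delta=n+m$. Number the passenger requests of $\mathcal{R}^*$ by $1,\dots,n$ and the parcel requests by $n+1,\dots,\delta$. Stop $i\in\{1,\dots,\delta\}$ is the origin of request $i$, and stop $i+\delta$ is its destination. Put $V^{p,o}=\{1,\dots,n\}$, $V^{f,o}=\{n+1,\dots,\delta\}$, $V=\{1,\dots,2\delta\}$; $0$ and $2\delta+1$ are virtual origin and destination depots. For stops $i,j\in V$, $\mathrm{TT}(i,j)$ means the travel time between their locations; travel times involving a virtual depot are $0$. Let $q_i\ge0$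 be the load of request $i$ for $i\le\delta$, $q_{i+\delta}=-q_i$, $q_0=q_{2\delta+1}=0$; write $t_i^s,t_i^*$ for the corresponding times of request $i$. The set $\mathcal{R}^*$ is called feasible (or: forms a trip, i.e. can be served by the same vehicle) if there exist $x_{i,j}\in\{0,1\}$ for $i,j\in V\cup\{0,2\delta+1\}$ and nonnegative reals $\tau_i,w_i,P_i$ for $i\in V\cup\{0,2\delta+1\}$ such that: (1) $\sum_{i\in V}x_{0,i}=1$ and $\sum_{i\in V}x_{i,2\delta+1}=1$; (2) for all $i\in V$: $\sum_{j\in V\cup\{2\delta+1\}}x_{i,j}=\sum_{j\in V\cup\{0\}}x_{j,i}=1$; (3) for all $i,j\in V\cup\{0,2\delta+1\}$: if $x_{i,j}=1$ then $\tau_j-\tau_i\ge \mathrm{TT}(i,j)$ and $w_j-w_i\ge q_j$; (4) for all $i\in V^{p,o}\cup V^{f,o}$: $t_i^s\le\tau_i\le t_i^s+\sigma$ and $\tau_i\le\tau_{\delta+i}$; (5) $\tau_{\delta+i}-t_i^*\le\Delta_P$ for $i\in V^{p,o}$ and $\tau_{\delta+i}-t_i^*\le\Delta_F$ for $i\in V^{f,o}$; (6) for all $i\in V\cup\{0,2\delta+1\}$: $\max\{0,q_i\}\le w_i\le\min\{Q,Q+q_i\}$; (7) for all $i,j\in V$: if $x_{i,j}=1$ then $P_j=P_i+1$; (8) $P_{j+\delta}-P_j-1\le\eta$ for all $j\in V^{p,o}$; and $0\le P_i\le 2\delta+1$ for all $i\in V$. *)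

theory Defs
  imports "Graph_Theory.Shortest_Path"
begin

record ('v, 'a, 'r) scenario =
  network :: "('v, 'a) pre_digraph"
  arc_length :: "'a \<Rightarrow> real"
  speed :: real
  passengers :: "'r set"
  parcels :: "'r set"
  origin :: "'r \<Rightarrow> 'v"
  destination :: "'r \<Rightarrow> 'v"
  submission :: "'r \<Rightarrow> real"
  load :: "'r \<Rightarrow> real"
  capacity :: real
  max_wait :: real
  max_delay_passenger :: real
  max_delay_parcel :: real
  max_stops :: nat

definition requests :: "('v, 'a, 'r) scenario \<Rightarrow> 'r set" where
  "requests I = passengers I \<union> parcels I"

locale ride_sharing_scenario =
  fin_digraph "network I" for I :: "('v, 'a, 'r) scenario" +
  assumes arc_length_pos: "a \<in> arcs (network I) \<Longrightarrow> arc_length I a > 0"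
    and all_reachable:
      "u \<in> verts (network I) \<Longrightarrow> v \<in> verts (network I) \<Longrightarrow> u \<rightarrow>\<^sup>*\<^bsub>network I\<^esub> v"
    and speed_pos: "speed I > 0"
    and finite_requests: "finite (requests I)"
    and disjoint_requests: "passengers I \<inter> parcels I = {}"
    and origin_vert: "p \<in> requests I \<Longrightarrow> origin I p \<in> verts (network I)"
    and destination_vert: "p \<in> requests I \<Longrightarrow> destination I p \<in> verts (network I)"
    and destination_neq_origin: "p \<in> requests I \<Longrightarrow> destination I p \<noteq> origin I p"
    and submission_nonneg: "p \<in> requests I \<Longrightarrow> submission I p \<ge> 0"
    and load_nonneg: "p \<in> requests I \<Longrightarrow> load I p \<ge> 0"
    and capacity_nonneg: "capacity I \<ge> 0"
    and max_wait_nonneg: "max_wait I \<ge> 0"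
    and max_delay_passenger_nonneg: "max_delay_passenger I \<ge> 0"
    and max_delay_parcel_nonneg: "max_delay_parcel I \<ge> 0"
    and passenger_load: "p \<in> passengers I \<Longrightarrow> capacity I < 2 * load I p"

(* The library's shortest-path distance is an extended real; it is finite between nodes
   of a strongly connected network with positive arc lengths. *)
definition travel_distance :: "('v, 'a, 'r) scenario \<Rightarrow> 'v \<Rightarrow> 'v \<Rightarrow> real" where
  "travel_distance I a b = real_of_ereal (wf_digraph.\<mu> (network I) (arc_length I) a b)"

definition travel_time :: "('v, 'a, 'r) scenario \<Rightarrow> 'v \<Rightarrow> 'v \<Rightarrow> real" where
  "travel_time I a b = travel_distance I a b / speed I"

definition earliest_arrival :: "('v, 'a, 'r) scenario \<Rightarrow> 'r \<Rightarrow> real" where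
  "earliest_arrival I p = submission I p + travel_time I (origin I p) (destination I p)"

(* Stops of d requests numbered 1, ..., d by num: stop i is the origin and stop i + d the
   destination of request num i; 0 and 2 * d + 1 are the virtual depots. *)
definition stop_location ::
    "('v, 'a, 'r) scenario \<Rightarrow> (nat \<Rightarrow> 'r) \<Rightarrow> nat \<Rightarrow> nat \<Rightarrow> 'v" where
  "stop_location I num d i =
     (if i \<le> d then origin I (num i) else destination I (num (i - d)))"

definition stop_travel_time ::
    "('v, 'a, 'r) scenario \<Rightarrow> (nat \<Rightarrow> 'r) \<Rightarrow> nat \<Rightarrow> nat \<Rightarrow> nat \<Rightarrow> real" where
  "stop_travel_time I num d i j =
     (if i \<in> {1..2*d} \<and> j \<in> {1..2*d}
      then travel_time I (stop_location I num d i) (stop_location I num d j) else 0)"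

definition stop_load :: "('v, 'a, 'r) scenario \<Rightarrow> (nat \<Rightarrow> 'r) \<Rightarrow> nat \<Rightarrow> nat \<Rightarrow> real" where
  "stop_load I num d i =
     (if i \<in> {1..d} then load I (num i)
      else if i \<in> {d+1..2*d} then - load I (num (i - d)) else 0)"

(* x: arcs driven by the vehicle; \<tau>: service times; w: loads; P: positions of the stops in
   the tour. Requests 1, ..., n are passengers, requests n + 1, ..., d are parcels. *)
definition valid_schedule ::
    "('v, 'a, 'r) scenario \<Rightarrow> (nat \<Rightarrow> 'r) \<Rightarrow> nat \<Rightarrow> nat \<Rightarrow> (nat \<Rightarrow> nat \<Rightarrow> nat) \<Rightarrow>
      (nat \<Rightarrow> real) \<Rightarrow> (nat \<Rightarrow> real) \<Rightarrow> (nat \<Rightarrow> real) \<Rightarrow> bool" where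
  "valid_schedule I num n d x \<tau> w P \<longleftrightarrow>
    (let V = {1..2*d}; N = {0..2*d+1}; TT = stop_travel_time I num d; q = stop_load I num d
     in (\<forall>i\<in>N. \<forall>j\<in>N. x i j \<in> {0, 1}) \<and>
        (\<forall>i\<in>N. 0 \<le> \<tau> i \<and> 0 \<le> w i \<and> 0 \<le> P i) \<and>
        (\<Sum>i\<in>V. x 0 i) = 1 \<and> (\<Sum>i\<in>V. x i (2*d+1)) = 1 \<and>
        (\<forall>i\<in>V. (\<Sum>j\<in>V \<union> {2*d+1}. x i j) = 1 \<and> (\<Sum>j\<in>V \<union> {0}. x j i) = 1) \<and>
        (\<forall>i\<in>N. \<forall>j\<in>N. x i j = 1 \<longrightarrow> \<tau> j - \<tau> i \<ge> TT i j \<and> w j - w i \<ge> q j) \<and>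
        (\<forall>i\<in>{1..d}. submission I (num i) \<le> \<tau> i \<and> \<tau> i \<le> submission I (num i) + max_wait I \<and>
           \<tau> i \<le> \<tau> (d + i)) \<and>
        (\<forall>i\<in>{1..n}. \<tau> (d + i) - earliest_arrival I (num i) \<le> max_delay_passenger I) \<and>
        (\<forall>i\<in>{n+1..d}. \<tau> (d + i) - earliest_arrival I (num i) \<le> max_delay_parcel I) \<and>
        (\<forall>i\<in>N. max 0 (q i) \<le> w i \<and> w i \<le> min (capacity I) (capacity I + q i)) \<and>
        (\<forall>i\<in>V. \<forall>j\<in>V. x i j = 1 \<longrightarrow> P j = P i + 1) \<and>
        (\<forall>j\<in>{1..n}. P (j + d) - P j - 1 \<le> real (max_stops I)) \<and>
        (\<forall>i\<in>V. 0 \<le> P i \<and> P i \<le> real (2*d+1)))"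

(* The numbering is arbitrary subject to passengers coming first: two such numberings only
   relabel the stops, so quantifying it existentially is the same as fixing one. *)
definition feasible :: "('v, 'a, 'r) scenario \<Rightarrow> 'r set \<Rightarrow> bool" where
  "feasible I S \<longleftrightarrow>
    (let n = card (S \<inter> passengers I); m = card (S \<inter> parcels I); d = n + m
     in \<exists>num. bij_betw num {1..n} (S \<inter> passengers I) \<and>
              bij_betw num {n+1..d} (S \<inter> parcels I) \<and>
              (\<exists>x \<tau> w P. valid_schedule I num n d x \<tau> w P))"

definition trips :: "('v, 'a, 'r) scenario \<Rightarrow> 'r set set" where
  "trips I = {S. S \<noteq> {} \<and> S \<subseteq> requests I \<and> feasible I S}"

definition trips_of_size :: "('v, 'a, 'r) scenario \<Rightarrow> nat \<Rightarrow> 'r set set" where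
  "trips_of_size I l = {p \<in> trips I. card p = l}"

definition max_index :: "('v, 'a, 'r) scenario \<Rightarrow> (nat \<Rightarrow> 'r) \<Rightarrow> 'r set \<Rightarrow> nat" where
  "max_index I r p = Max {j. 1 \<le> j \<and> j \<le> card (requests I) \<and> r j \<in> p}"

end

theory Submission
  imports Defs
begin

text \<open>Everything rests on trips being closed under nonempty subsets: dropping the stops of a request
  from a vehicle's route keeps the route feasible, because shortest paths satisfy the triangle
  inequality, the load on board only drops, and no passenger sees more intermediate stops. The load
  variables of a schedule only bound the true load from above, so after dropping a request they are
  replaced by the true load. A trip of size l + 1 thus arises from the trip of size l obtained by
  removing its request of highest index.\<close>

text \<open>The obstacle is the encoding. In a schedule the numbers of the stops and the delivery
  offset \<open>d\<close> depend on how many requests there are, and the intermediate stops of a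
  passenger are read off from differences of \<open>P\<close>. Deleting a request would renumber
  everything. Hence no request is ever deleted from a schedule: a schedule is turned into a
  \<open>tour\<close>, an order of stops with service times, which is restricted and then turned
  into a new schedule.

  Two facts are hidden in the constraints. The degree conditions on \<open>x\<close> alone would
  allow cycles apart from the route; since \<open>P\<close> rises by one along each arc between
  stops, only a single path through all stops remains. And a pickup strictly precedes its delivery
  in the order, although only a weak inequality of times is demanded. This strict order lets the
  load on board be written as a sum of nonnegative contributions of the single requests, a form in
  which dropping requests can only lower it.\<close>

section \<open>Travel times: triangle inequality and positivity\<close>

context ride_sharing_scenario
begin

lemma travel_distance_eq_cost:
  assumes "u \<in> verts (network I)" "v \<in> verts (network I)"
  obtains p where "awalk u p v" "travel_distance I u v = awalk_cost (arc_length I) p"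
proof -
  obtain p where "apath u p v" "\<mu> (arc_length I) u v = awalk_cost (arc_length I) p"
    using min_cost_awalk[OF all_reachable[OF assms], of "arc_length I"] arc_length_pos
    by (force simp: less_imp_le)
  then show ?thesis
    by (intro that[of p]) (auto simp: travel_distance_def apath_def)
qed

text \<open>The minimizing \<open>q\<close> serves to show that \<open>\<mu>\<close> is a real
  number here, so that the conversion from extended reals respects the inequality.\<close>

lemma travel_distance_le_cost:
  assumes "u \<in> verts (network I)" "v \<in> verts (network I)" "awalk u p v"
  shows "travel_distance I u v \<le> awalk_cost (arc_length I) p"
proof -
  obtain q where "\<mu> (arc_length I) u v = awalk_cost (arc_length I) q"
    using min_cost_awalk[OF all_reachable[OF assms(1,2)], of "arc_length I"] arc_length_pos
    by (force simp: less_imp_le)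
  with min_cost_le_walk_cost[OF assms(3), of "arc_length I"] show ?thesis
    by (simp add: travel_distance_def)
qed

lemma travel_time_triangle:
  assumes "u \<in> verts (network I)" "v \<in> verts (network I)" "z \<in> verts (network I)"
  shows "travel_time I u z \<le> travel_time I u v + travel_time I v z"
proof -
  obtain p q where p: "awalk u p v" "travel_distance I u v = awalk_cost (arc_length I) p"
    and q: "awalk v q z" "travel_distance I v z = awalk_cost (arc_length I) q"
    using travel_distance_eq_cost assms by metis
  have "travel_distance I u z \<le> awalk_cost (arc_length I) (p @ q)"
    using p q assms by (intro travel_distance_le_cost awalk_appendI)
  then show ?thesis
    using p q speed_pos by (simp add: travel_time_def add_divide_distrib[symmetric] divide_right_mono)
qed

text \<open>A shortest walk between distinct nodes has a first arc, which has positive length, and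
  the rest of the walk cannot cost less than 0.\<close>

lemma travel_time_pos:
  assumes "u \<in> verts (network I)" "v \<in> verts (network I)" "u \<noteq> v"
  shows "0 < travel_time I u v"
proof -
  obtain p where p: "awalk u p v" "travel_distance I u v = awalk_cost (arc_length I) p"
    using travel_distance_eq_cost assms by blast
  with \<open>u \<noteq> v\<close> obtain a as where as: "p = a # as"
    by (cases p) (auto simp: awalk_Nil_iff)
  with p have "a \<in> arcs (network I)" "awalk (head (network I) a) as v"
    by (auto simp: awalk_Cons_iff)
  then have "0 < arc_length I a" "0 \<le> awalk_cost (arc_length I) as"
    using pos_cost_pos_awalk_cost arc_length_pos by (auto simp: less_imp_le)
  then show ?thesis
    using p as speed_pos by (simp add: travel_time_def)
qed

end

section \<open>Extracting and compressing linear orders\<close>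

text \<open>Every node except the first one, \<open>f\<close>, has a predecessor in
  \<open>V\<close>. Going back lowers \<open>P\<close> by one, and as \<open>P\<close> is
  nonnegative this must end, necessarily at \<open>f\<close>; so \<open>P\<close> exceeds
  \<open>P f\<close> by a natural number \<open>rk\<close>. Two nodes of equal rank have
  predecessors of equal rank, which coincide by induction, and successors are unique; hence
  \<open>rk\<close> is injective.\<close>

lemma hamiltonian_path_ranking:
  fixes x :: "'b \<Rightarrow> 'b \<Rightarrow> nat" and P :: "'b \<Rightarrow> real"
  assumes fin: "finite V" and s: "s \<notin> V" and t: "t \<notin> V"
    and src: "(\<Sum>i\<in>V. x s i) = 1"
    and out: "\<And>i. i \<in> V \<Longrightarrow> (\<Sum>j\<in>V \<union> {t}. x i j) = 1"
    and inn: "\<And>i. i \<in> V \<Longrightarrow> (\<Sum>j\<in>V \<union> {s}. x j i) = 1"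
    and P_step: "\<And>i j. i \<in> V \<Longrightarrow> j \<in> V \<Longrightarrow> x i j = 1 \<Longrightarrow> P j = P i + 1"
    and P_nonneg: "\<And>i. i \<in> V \<Longrightarrow> 0 \<le> P i"
  obtains f and rk :: "'b \<Rightarrow> nat" where
    "f \<in> V" "rk f = 0" "inj_on rk V"
    "\<And>i. i \<in> V \<Longrightarrow> P i = P f + rk i"
    "\<And>j. j \<in> V \<Longrightarrow> j = f \<or> (\<exists>i\<in>V. x i j = 1 \<and> rk j = Suc (rk i))"
proof -
  obtain f where f: "f \<in> V" "x s f = 1" and f_unique: "\<And>i. i \<in> V \<Longrightarrow> i \<noteq> f \<Longrightarrow> x s i = 0"
    using src by (subst (asm) sum_eq_1_iff[OF fin]) (metis)
  have pred: "\<exists>i\<in>V. x i j = 1" if j: "j \<in> V" "j \<noteq> f" for j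
  proof -
    obtain i where "i \<in> V \<union> {s}" "x i j = 1"
      using inn[OF j(1)] fin by (subst (asm) sum_eq_1_iff) auto
    then show ?thesis using f_unique[OF j] by auto
  qed
  have succ_unique: "j = j'" if "i \<in> V" "j \<in> V" "j' \<in> V" "x i j = 1" "x i j' = 1" for i j j'
  proof -
    have "\<exists>a\<in>V \<union> {t}. x i a = 1 \<and> (\<forall>b\<in>V \<union> {t}. a \<noteq> b \<longrightarrow> x i b = 0)"
      using out[OF that(1)] fin by (subst (asm) sum_eq_1_iff) auto
    then show ?thesis using that by (metis UnI1 zero_neq_one)
  qed
  have rank: "\<exists>k::nat. P j = P f + k" if "j \<in> V" for j
    using that
  \<comment> \<open>\<open>P\<close> is real valued, so the descent is measured by its floor; as
    \<open>P\<close> is nonnegative, \<open>nat\<close> truncates nothing and a step back lowers the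
    measure.\<close>
  proof (induction "nat \<lfloor>P j\<rfloor>" arbitrary: j rule: less_induct)
    case less
    show ?case
    proof (cases "j = f")
      case True
      then show ?thesis by (intro exI[of _ 0]) simp
    next
      case False
      with pred less.prems obtain i where i: "i \<in> V" "x i j = 1" by blast
      then have "P j = P i + 1" using P_step less.prems by blast
      moreover from this have "nat \<lfloor>P i\<rfloor> < nat \<lfloor>P j\<rfloor>"
        using P_nonneg[OF i(1)] by simp
      ultimately obtain k :: nat where "P i = P f + k" using less.hyps i by blast
      then show ?thesis using \<open>P j = P i + 1\<close> by (intro exI[of _ "Suc k"]) simp
    qed
  qed
  then obtain rk :: "'b \<Rightarrow> nat" where rk: "\<And>j. j \<in> V \<Longrightarrow> P j = P f + rk j" by metis
  have rk_f: "rk f = 0" using rk[OF f(1)] by simp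
  have step: "\<exists>i\<in>V. x i j = 1 \<and> rk j = Suc (rk i)" if j: "j \<in> V" "j \<noteq> f" for j
  proof -
    obtain i where i: "i \<in> V" "x i j = 1" using pred[OF j] by blast
    then have "real (rk j) = real (Suc (rk i))"
      using P_step[OF i(1) j(1) i(2)] rk[OF i(1)] rk[OF j(1)] by simp
    then show ?thesis using i by (metis of_nat_eq_iff)
  qed
  have "i = j" if "i \<in> V" "j \<in> V" "rk i = rk j" for i j
    using that
  proof (induction "rk i" arbitrary: i j)
    case 0
    then show ?case using step by (metis nat.distinct(1))
  next
    case (Suc k)
    then have "i \<noteq> f" "j \<noteq> f" using rk_f by auto
    then obtain i' j' where i': "i' \<in> V" "x i' i = 1" "rk i = Suc (rk i')"
      and j': "j' \<in> V" "x j' j = 1" "rk j = Suc (rk j')"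
      using step Suc.prems by metis
    then have "i' = j'" using Suc by simp
    then show ?case using succ_unique i' j' Suc.prems by blast
  qed
  then show ?thesis
    using that[OF f(1) rk_f _ rk] step by (meson inj_onI)
qed

text \<open>Counting the elements with value at most \<open>f x\<close> includes \<open>x\<close>
  itself, so ranks start at 1; an injection into a set of the same finite size is onto.\<close>

lemma finite_inj_rank:
  fixes f :: "'b \<Rightarrow> 'c::linorder"
  assumes "finite A" "inj_on f A"
  obtains g :: "'b \<Rightarrow> nat" where "bij_betw g A {1..card A}"
    "\<And>x y. x \<in> A \<Longrightarrow> y \<in> A \<Longrightarrow> g x < g y \<longleftrightarrow> f x < f y"
proof -
  define g where "g x = card {y \<in> A. f y \<le> f x}" for x
  have less: "g x < g y" if "y \<in> A" "f x < f y" for x y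
  proof -
    have "{y \<in> A. f y \<le> f x} \<subset> {z \<in> A. f z \<le> f y}"
    proof
      show "{y \<in> A. f y \<le> f x} \<subseteq> {z \<in> A. f z \<le> f y}" using that by auto
      have "y \<in> {z \<in> A. f z \<le> f y}" "y \<notin> {y \<in> A. f y \<le> f x}" using that by auto
      then show "{y \<in> A. f y \<le> f x} \<noteq> {z \<in> A. f z \<le> f y}" by blast
    qed
    then show ?thesis unfolding g_def using assms(1) by (intro psubset_card_mono) auto
  qed
  have le: "g x \<le> g y" if "f x \<le> f y" for x y
    unfolding g_def using that assms(1) by (intro card_mono) auto
  have iff: "g x < g y \<longleftrightarrow> f x < f y" if "x \<in> A" "y \<in> A" for x y
    using less[OF that(2)] le by (meson linorder_not_less)
  have "inj_on g A"
    using assms(2) iff by (metis inj_on_def linorder_neqE order_less_irrefl)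
  moreover have "g x \<in> {1..card A}" if "x \<in> A" for x
  proof -
    have "0 < card {y \<in> A. f y \<le> f x}" using that assms(1) by (auto simp: card_gt_0_iff)
    moreover have "card {y \<in> A. f y \<le> f x} \<le> card A" using assms(1) by (intro card_mono) auto
    ultimately show ?thesis by (simp add: g_def)
  qed
  then have "g ` A \<subseteq> {1..card A}" by blast
  ultimately have "bij_betw g A {1..card A}"
    by (simp add: bij_betw_def card_image card_subset_eq)
  then show ?thesis using that iff by blast
qed

text \<open>This yields the degree constraints on \<open>x\<close>: exactly one stop or depot has
  the rank next to a given one.\<close>

lemma sum_indicator_bij_betw:
  assumes "bij_betw f A B" "finite A" "k \<in> B"
  shows "(\<Sum>j\<in>A. if f j = k then 1 else 0) = (1::nat)"
  using sum.reindex_bij_betw[OF assms(1), of "\<lambda>b. if b = k then 1 else (0::nat)"]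
    bij_betw_finite[OF assms(1)] assms by simp

section \<open>Tours: a form of feasibility without numbering\<close>

text \<open>A stop is a pair of a request and a flag, False for the pickup and True for the delivery.\<close>

definition place :: "('v, 'a, 'r) scenario \<Rightarrow> 'r \<times> bool \<Rightarrow> 'v" where
  "place I s = (if snd s then destination I (fst s) else origin I (fst s))"

definition load_change :: "('v, 'a, 'r) scenario \<Rightarrow> 'r \<times> bool \<Rightarrow> real" where
  "load_change I s = (if snd s then - load I (fst s) else load I (fst s))"

text \<open>The load on leaving position \<open>k\<close>: a pickup at \<open>k\<close> counts, a
  delivery at \<open>k\<close> no longer does. Summing over requests instead of adding signed
  changes makes monotonicity in \<open>S\<close> visible when loads are nonnegative.\<close>

definition onboard_load ::
    "('v, 'a, 'r) scenario \<Rightarrow> 'r set \<Rightarrow> ('r \<times> bool \<Rightarrow> nat) \<Rightarrow> nat \<Rightarrow> real" where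
  "onboard_load I S pos k =
    (\<Sum>p\<in>S. if pos (p, False) \<le> k \<and> k < pos (p, True) then load I p else 0)"

text \<open>Travel times are required between all ordered pairs of stops, not only consecutive ones, and
  stops in between are counted rather than read off as differences of positions. This makes the
  notion independent of the numbering and inherited by subsets without renumbering.\<close>

definition tour ::
    "('v, 'a, 'r) scenario \<Rightarrow> 'r set \<Rightarrow> ('r \<times> bool \<Rightarrow> nat) \<Rightarrow> ('r \<times> bool \<Rightarrow> real) \<Rightarrow> bool" where
  "tour I S pos \<tau> \<longleftrightarrow>
    inj_on pos (S \<times> UNIV) \<and>
    (\<forall>s\<in>S \<times> UNIV. \<forall>t\<in>S \<times> UNIV. pos s < pos t \<longrightarrow>
       travel_time I (place I s) (place I t) \<le> \<tau> t - \<tau> s) \<and>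
    (\<forall>p\<in>S. pos (p, False) < pos (p, True) \<and> \<tau> (p, False) \<le> \<tau> (p, True) \<and>
       submission I p \<le> \<tau> (p, False) \<and> \<tau> (p, False) \<le> submission I p + max_wait I) \<and>
    (\<forall>p\<in>S \<inter> passengers I. \<tau> (p, True) - earliest_arrival I p \<le> max_delay_passenger I) \<and>
    (\<forall>p\<in>S \<inter> parcels I. \<tau> (p, True) - earliest_arrival I p \<le> max_delay_parcel I) \<and>
    (\<forall>s\<in>S \<times> UNIV. onboard_load I S pos (pos s) \<le> min (capacity I) (capacity I + load_change I s)) \<and>
    (\<forall>p\<in>S \<inter> passengers I.
       card {s \<in> S \<times> UNIV. pos (p, False) < pos s \<and> pos s < pos (p, True)} \<le> max_stops I)"

text \<open>Grouping by request, the two changes cancel once the delivery has been made; a delivery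
  in the prefix without its pickup is excluded by the assumed order. Thus the bookkeeping of a
  schedule meets that of a tour.\<close>

lemma sum_load_change:
  assumes "finite S" "\<And>p. p \<in> S \<Longrightarrow> pos (p, False) < pos (p, True)"
  shows "(\<Sum>t\<in>{t \<in> S \<times> UNIV. pos t \<le> k}. load_change I t) = onboard_load I S pos k"
proof -
  have "(\<Sum>t\<in>{t \<in> S \<times> UNIV. pos t \<le> k}. load_change I t) =
      (\<Sum>t\<in>S \<times> UNIV. if pos t \<le> k then load_change I t else 0)"
    using assms(1) by (intro sum.inter_filter) auto
  also have "\<dots> = (\<Sum>p\<in>S. \<Sum>b\<in>UNIV. if pos (p, b) \<le> k then load_change I (p, b) else 0)"
    by (simp add: sum.cartesian_product)
  also have "\<dots> = onboard_load I S pos k"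
    unfolding onboard_load_def
  proof (rule sum.cong[OF refl])
    fix p assume "p \<in> S"
    from assms(2)[OF this] show
      "(\<Sum>b\<in>UNIV. if pos (p, b) \<le> k then load_change I (p, b) else 0) =
        (if pos (p, False) \<le> k \<and> k < pos (p, True) then load I p else 0)"
      by (auto simp: UNIV_bool load_change_def)
  qed
  finally show ?thesis .
qed

lemma onboard_load_nonneg:
  assumes "\<And>p. p \<in> S \<Longrightarrow> 0 \<le> load I p"
  shows "0 \<le> onboard_load I S pos k"
  unfolding onboard_load_def using assms by (intro sum_nonneg) auto

lemma load_le_onboard_load:
  assumes "finite S" "\<And>p. p \<in> S \<Longrightarrow> 0 \<le> load I p"
    and "p \<in> S" "pos (p, False) \<le> k" "k < pos (p, True)"
  shows "load I p \<le> onboard_load I S pos k"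
  using member_le_sum[of p S "\<lambda>p. if pos (p, False) \<le> k \<and> k < pos (p, True) then load I p else 0"] assms
  by (auto simp: onboard_load_def)

text \<open>The same \<open>pos\<close> and \<open>\<tau>\<close> serve the smaller set, since gaps
  between positions are allowed. Each condition either quantifies universally over stops or
  requests, or bounds a load or a count that can only shrink.\<close>

lemma tour_subset:
  fixes S :: "'r set"
  assumes tour: "tour I S pos \<tau>" and "S' \<subseteq> S" "finite S" and load: "\<And>p. p \<in> S \<Longrightarrow> 0 \<le> load I p"
  shows "tour I S' pos \<tau>"
proof -
  have "onboard_load I S' pos k \<le> onboard_load I S pos k" for k
    unfolding onboard_load_def using assms by (intro sum_mono2) auto
  moreover have "card {s \<in> S' \<times> UNIV. a < pos s \<and> pos s < b} \<le>
      card {s \<in> S \<times> UNIV. a < pos s \<and> pos s < b}" for a b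
    using assms(2,3) by (intro card_mono) auto
  moreover have sub: "s \<in> S \<times> UNIV" if "s \<in> S' \<times> UNIV" for s :: "'r \<times> bool"
    using that assms(2) by auto
  moreover have "inj_on pos (S' \<times> UNIV)"
    using tour sub by (auto simp: tour_def intro: inj_on_subset)
  moreover have "p \<in> S \<inter> passengers I" if "p \<in> S' \<inter> passengers I" for p
    using that assms(2) by auto
  moreover have "p \<in> S \<inter> parcels I" if "p \<in> S' \<inter> parcels I" for p
    using that assms(2) by auto
  ultimately show ?thesis
    using tour assms(2) unfolding tour_def by (meson order_trans subsetD)
qed

text \<open>Only the order of positions matters in a tour. Closing the gaps makes counts of
  intermediate stops agree again with differences of positions, as a schedule requires.\<close>

lemma tour_normalize:
  fixes S :: "'r set"
  assumes tour: "tour I S pos \<tau>" and "finite S"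
  obtains pos' where "tour I S pos' \<tau>" "bij_betw pos' (S \<times> UNIV) {1..2 * card S}"
proof -
  have "finite (S \<times> (UNIV :: bool set))" using assms(2) by simp
  moreover have "inj_on pos (S \<times> UNIV)" using tour by (simp add: tour_def)
  ultimately obtain pos' :: "'r \<times> bool \<Rightarrow> nat" where
      bij: "bij_betw pos' (S \<times> UNIV) {1..card (S \<times> (UNIV :: bool set))}"
    and less: "\<And>s t. s \<in> S \<times> UNIV \<Longrightarrow> t \<in> S \<times> UNIV \<Longrightarrow> pos' s < pos' t \<longleftrightarrow> pos s < pos t"
    using finite_inj_rank by blast
  have "onboard_load I S pos' (pos' s) = onboard_load I S pos (pos s)" if "s \<in> S \<times> UNIV" for s
    unfolding onboard_load_def using that
    \<comment> \<open>Only strict comparisons are known to be preserved, so the weak one in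
      \<open>onboard_load\<close> is turned into a negated strict one.\<close>
    by (intro sum.cong refl) (auto simp: less simp flip: not_less)
  moreover have "{s \<in> S \<times> UNIV. pos' (p, False) < pos' s \<and> pos' s < pos' (p, True)} =
      {s \<in> S \<times> UNIV. pos (p, False) < pos s \<and> pos s < pos (p, True)}" if "p \<in> S" for p
    using that by (auto simp: less)
  ultimately have "tour I S pos' \<tau>"
    using tour bij less unfolding tour_def bij_betw_def by simp
  then show ?thesis using that bij by (simp add: card_cartesian_product mult.commute)
qed


section \<open>Numbered stops as pairs of request and flag\<close>

definition stop :: "(nat \<Rightarrow> 'r) \<Rightarrow> nat \<Rightarrow> nat \<Rightarrow> 'r \<times> bool" where
  "stop num d i = (if i \<le> d then (num i, False) else (num (i - d), True))"

lemma stop_simps [simp]: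
  "i \<le> d \<Longrightarrow> stop num d i = (num i, False)"
  "1 \<le> i \<Longrightarrow> stop num d (d + i) = (num i, True)"
  "1 \<le> i \<Longrightarrow> stop num d (i + d) = (num i, True)"
  by (auto simp: stop_def)

lemma bij_betw_stop:
  assumes "bij_betw num {1..d} S"
  shows "bij_betw (stop num d) {1..2 * d} (S \<times> UNIV)"
proof (rule bij_betw_imageI)
  have inj: "inj_on num {1..d}" and img: "num ` {1..d} = S"
    using assms by (auto simp: bij_betw_def)
  show "inj_on (stop num d) {1..2 * d}"
  proof (rule inj_onI)
    fix i j assume *: "i \<in> {1..2 * d}" "j \<in> {1..2 * d}" "stop num d i = stop num d j"
    show "i = j"
    proof (cases "i \<le> d")
      case True
      then show ?thesis
        using * inj_onD[OF inj, of i j] by (simp add: stop_def split: if_splits)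
    next
      case False
      with * have "\<not> j \<le> d" "num (i - d) = num (j - d)"
        by (simp_all add: stop_def split: if_splits)
      with False * have "i - d = j - d" by (intro inj_onD[OF inj]) auto
      with False \<open>\<not> j \<le> d\<close> show ?thesis by simp
    qed
  qed
  show "stop num d ` {1..2 * d} = S \<times> UNIV"
  proof (intro equalityI subsetI)
    fix s assume "s \<in> stop num d ` {1..2 * d}"
    then obtain i where i: "i \<in> {1..2 * d}" "s = stop num d i" by blast
    then have "(if i \<le> d then i else i - d) \<in> {1..d}" by auto
    with img have "num (if i \<le> d then i else i - d) \<in> S" by blast
    with i show "s \<in> S \<times> UNIV" by (auto simp: stop_def)
  next
    fix s :: "'a \<times> bool" assume "s \<in> S \<times> UNIV"
    then obtain i b where i: "i \<in> {1..d}" "s = (num i, b)" using img by (cases s) auto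
    then have "s = stop num d (if b then d + i else i)" by auto
    moreover have "(if b then d + i else i) \<in> {1..2 * d}" using i by auto
    ultimately show "s \<in> stop num d ` {1..2 * d}" by blast
  qed
qed

lemma stop_location_eq_place: "stop_location I num d i = place I (stop num d i)"
  by (simp add: stop_location_def place_def stop_def)

lemma stop_travel_time_eq:
  assumes "i \<in> {1..2 * d}" "j \<in> {1..2 * d}"
  shows "stop_travel_time I num d i j =
    travel_time I (place I (stop num d i)) (place I (stop num d j))"
  using assms by (simp add: stop_travel_time_def stop_location_eq_place)

lemma stop_load_eq_load_change:
  assumes "i \<in> {1..2 * d}"
  shows "stop_load I num d i = load_change I (stop num d i)"
  using assms by (auto simp: stop_load_def load_change_def stop_def)

section \<open>Schedules and tours are equivalent\<close>

context ride_sharing_scenario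
begin

lemma place_vert:
  assumes "S \<subseteq> requests I" "s \<in> S \<times> UNIV"
  shows "place I s \<in> verts (network I)"
  using assms origin_vert destination_vert by (auto simp: place_def)

text \<open>Positions are the ranks along the path. The arc constraints are chained along it: travel
  times by the triangle inequality, loads by summation.\<close>

lemma valid_schedule_imp_tour:
  assumes num: "bij_betw num {1..d} S" and S: "S \<subseteq> requests I" and "n \<le> d"
    and passengers: "bij_betw num {1..n} (S \<inter> passengers I)"
    and parcels: "bij_betw num {n+1..d} (S \<inter> parcels I)"
    and valid: "valid_schedule I num n d x \<tau> w P"
  shows "\<exists>pos \<tau>'. tour I S pos \<tau>'"
proof -
  let ?V = "{1..2 * d}" and ?st = "stop num d"
  have V_depots: "?V \<subseteq> {0..2 * d + 1}" by auto
  note v = valid[unfolded valid_schedule_def Let_def]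
  from v have "\<forall>i\<in>{0..2 * d + 1}. 0 \<le> \<tau> i \<and> 0 \<le> w i \<and> 0 \<le> P i" by (elim conjE)
  with V_depots have P_nonneg: "\<And>i. i \<in> ?V \<Longrightarrow> 0 \<le> P i" by blast
  from v have source: "(\<Sum>i\<in>?V. x 0 i) = 1" by (elim conjE)
  from v have "\<forall>i\<in>?V. (\<Sum>j\<in>?V \<union> {2 * d + 1}. x i j) = 1 \<and> (\<Sum>j\<in>?V \<union> {0}. x j i) = 1"
    by (elim conjE)
  then have out_degree: "\<And>i. i \<in> ?V \<Longrightarrow> (\<Sum>j\<in>?V \<union> {2 * d + 1}. x i j) = 1"
    and in_degree: "\<And>i. i \<in> ?V \<Longrightarrow> (\<Sum>j\<in>?V \<union> {0}. x j i) = 1"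
    by blast+
  from v have "\<forall>i\<in>{0..2 * d + 1}. \<forall>j\<in>{0..2 * d + 1}. x i j = 1 \<longrightarrow>
      stop_travel_time I num d i j \<le> \<tau> j - \<tau> i \<and> stop_load I num d j \<le> w j - w i"
    by (elim conjE)
  with V_depots have arc: "\<And>i j. \<lbrakk>i \<in> ?V; j \<in> ?V; x i j = 1\<rbrakk> \<Longrightarrow>
      stop_travel_time I num d i j \<le> \<tau> j - \<tau> i \<and> stop_load I num d j \<le> w j - w i"
    by blast
  from v have "\<forall>i\<in>{0..2 * d + 1}. max 0 (stop_load I num d i) \<le> w i \<and>
      w i \<le> min (capacity I) (capacity I + stop_load I num d i)"
    by (elim conjE)
  with V_depots have load_bounds: "\<And>i. i \<in> ?V \<Longrightarrow> stop_load I num d i \<le> w i \<and>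
      w i \<le> min (capacity I) (capacity I + stop_load I num d i)"
    by (meson max.boundedE subsetD)
  from v have "\<forall>i\<in>{1..d}. submission I (num i) \<le> \<tau> i \<and>
      \<tau> i \<le> submission I (num i) + max_wait I \<and> \<tau> i \<le> \<tau> (d + i)"
    by (elim conjE)
  note window = bspec[OF this]
  from v have "\<forall>i\<in>{1..n}. \<tau> (d + i) - earliest_arrival I (num i) \<le> max_delay_passenger I"
    by (elim conjE)
  note delay_passenger = bspec[OF this]
  from v have "\<forall>i\<in>{n+1..d}. \<tau> (d + i) - earliest_arrival I (num i) \<le> max_delay_parcel I"
    by (elim conjE)
  note delay_parcel = bspec[OF this]
  from v have "\<forall>i\<in>?V. \<forall>j\<in>?V. x i j = 1 \<longrightarrow> P j = P i + 1" by (elim conjE)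
  then have P_step: "\<And>i j. i \<in> ?V \<Longrightarrow> j \<in> ?V \<Longrightarrow> x i j = 1 \<Longrightarrow> P j = P i + 1" by blast
  from v have "\<forall>j\<in>{1..n}. P (j + d) - P j - 1 \<le> real (max_stops I)" by (elim conjE)
  note stops = bspec[OF this]
  have depots: "0 \<notin> ?V" "2 * d + 1 \<notin> ?V" by auto
  obtain f and rk :: "nat \<Rightarrow> nat" where f: "f \<in> ?V" "rk f = 0"
    and inj: "inj_on rk ?V" and P_rk: "\<And>i. i \<in> ?V \<Longrightarrow> P i = P f + rk i"
    and pred: "\<And>j. j \<in> ?V \<Longrightarrow> j = f \<or> (\<exists>i\<in>?V. x i j = 1 \<and> rk j = Suc (rk i))"
    by (rule hamiltonian_path_ranking[of ?V 0 "2 * d + 1" x P, OF finite_atLeastAtMost depots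
          source out_degree in_degree P_step P_nonneg]) (assumption | blast intro: that)+
  note st_bij = bij_betw_stop[OF num]
  have st_mem: "?st i \<in> S \<times> UNIV" if "i \<in> ?V" for i
    using bij_betwE[OF st_bij] that by blast
  have travel: "travel_time I (place I (?st i)) (place I (?st j)) \<le> \<tau> j - \<tau> i"
    if "i \<in> ?V" "j \<in> ?V" "rk i < rk j" for i j
    using that
  proof (induction "rk j" arbitrary: j rule: less_induct)
    case less
    then obtain k where k: "k \<in> ?V" "x k j = 1" "rk j = Suc (rk k)"
      using pred[of j] f by auto
    have last: "travel_time I (place I (?st k)) (place I (?st j)) \<le> \<tau> j - \<tau> k"
      using arc[OF k(1) less.prems(2) k(2)] k less.prems by (simp add: stop_travel_time_eq)
    show ?case
    proof (cases "rk i = rk k")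
      case True
      then show ?thesis using inj_onD[OF inj _ less.prems(1) k(1)] last by simp
    next
      case False
      then have "travel_time I (place I (?st i)) (place I (?st k)) \<le> \<tau> k - \<tau> i"
        using less k by simp
      moreover have "travel_time I (place I (?st i)) (place I (?st j)) \<le>
          travel_time I (place I (?st i)) (place I (?st k)) +
          travel_time I (place I (?st k)) (place I (?st j))"
        using less.prems k st_mem by (intro travel_time_triangle place_vert[OF S])
      ultimately show ?thesis using last by simp
    qed
  qed
  \<comment> \<open>An arc only gives that \<open>w\<close> grows by at least the load change, so
    summing from the first stop, where \<open>w\<close> is at least its load change, bounds the true
    load by \<open>w\<close>. The capacity bounds on \<open>w\<close> thus pass to the true
    load.\<close>
  have load_sum: "(\<Sum>i\<in>{i \<in> ?V. rk i \<le> rk j}. stop_load I num d i) \<le> w j" if "j \<in> ?V" for j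
    using that
  proof (induction "rk j" arbitrary: j)
    case 0
    then have "i = j" if "i \<in> ?V" "rk i \<le> rk j" for i
      using inj_onD[OF inj _ that(1), of j] that by simp
    with 0(2) have "{i \<in> ?V. rk i \<le> rk j} = {j}" by blast
    then show ?case using load_bounds[OF 0(2)] by simp
  next
    case (Suc k)
    then obtain i where i: "i \<in> ?V" "x i j = 1" "rk j = Suc (rk i)"
      using pred[of j] f by auto
    have "l = j \<or> rk l \<le> rk i" if "l \<in> ?V" "rk l \<le> rk j" for l
      using inj_onD[OF inj _ that(1) Suc.prems] that(2) i(3) by (simp add: le_Suc_eq) blast
    moreover have "rk i \<le> rk j" using i(3) by simp
    ultimately have "{l \<in> ?V. rk l \<le> rk j} = insert j {l \<in> ?V. rk l \<le> rk i}"
      using Suc.prems by (blast intro: order_trans)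
    moreover have "j \<notin> {l \<in> ?V. rk l \<le> rk i}" using i(3) by simp
    ultimately show ?case
      using Suc.hyps(1)[of i] Suc.hyps(2) i arc[OF i(1) Suc.prems i(2)] by simp
  qed
  \<comment> \<open>The schedule only requires pickup time at most delivery time; since origin and destination
    differ, driving from the delivery back to the pickup would take positive time.\<close>
  have pickup_first: "rk i < rk (d + i)" if "i \<in> {1..d}" for i
  proof (rule ccontr)
    assume "\<not> ?thesis"
    moreover have iV: "i \<in> ?V" "d + i \<in> ?V" using that by auto
    moreover have "rk i \<noteq> rk (d + i)"
      using inj_onD[OF inj _ iV] that by fastforce
    ultimately have "rk (d + i) < rk i" by simp
    then have "travel_time I (place I (?st (d + i))) (place I (?st i)) \<le> \<tau> i - \<tau> (d + i)"
      using travel iV by blast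
    moreover have "0 < travel_time I (place I (?st (d + i))) (place I (?st i))"
    proof (intro travel_time_pos place_vert[OF S] st_mem iV)
      have "num i \<in> requests I" using bij_betwE[OF num] S that by blast
      then show "place I (?st (d + i)) \<noteq> place I (?st i)"
        using destination_neq_origin that by (simp add: place_def)
    qed
    ultimately show False using window[OF that] by simp
  qed
  define g where "g = inv_into ?V ?st"
  have g_st [simp]: "g (?st i) = i" if "i \<in> ?V" for i
    unfolding g_def using st_bij that by (simp add: bij_betw_inv_into_left)
  define pos where "pos s = rk (g s)" for s
  have pos_st [simp]: "pos (?st i) = rk i" if "i \<in> ?V" for i
    using that by (simp add: pos_def)
  have stop_cases: "\<exists>i\<in>?V. s = ?st i" if "s \<in> S \<times> UNIV" for s
    using st_bij that by (auto simp: bij_betw_def)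
  have request_cases: "\<exists>i\<in>A. p = num i" if "bij_betw num A B" "p \<in> B" for p A B
    using that by (auto simp: bij_betw_def)
  have pos_num: "pos (num i, False) = rk i" "pos (num i, True) = rk (d + i)"
      "g (num i, False) = i" "g (num i, True) = d + i" if "i \<in> {1..d}" for i
    using that pos_st[of i] pos_st[of "d + i"] g_st[of i] g_st[of "d + i"] by auto
  have finS: "finite S" using S finite_requests by (rule finite_subset)
  have pickup_pos: "pos (p, False) < pos (p, True)" if "p \<in> S" for p
    using request_cases[OF num that] pickup_first by (auto simp: pos_num)
  have inj_pos: "inj_on pos (S \<times> UNIV)"
  proof (rule inj_onI)
    fix s t :: "'r \<times> bool"
    assume st: "s \<in> S \<times> UNIV" "t \<in> S \<times> UNIV" "pos s = pos t"
    obtain i j where ij: "i \<in> ?V" "s = ?st i" "j \<in> ?V" "t = ?st j"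
      using stop_cases[OF st(1)] stop_cases[OF st(2)] by blast
    then show "s = t" using st(3) inj_onD[OF inj _ ij(1,3)] by simp
  qed
  have "tour I S pos (\<tau> \<circ> g)"
    unfolding tour_def
  proof (intro conjI ballI impI)
    show "inj_on pos (S \<times> UNIV)" by (fact inj_pos)
  next
    fix s t assume *: "s \<in> S \<times> UNIV" "t \<in> S \<times> UNIV" "pos s < pos t"
    obtain i j where "i \<in> ?V" "s = ?st i" "j \<in> ?V" "t = ?st j"
      using stop_cases[OF *(1)] stop_cases[OF *(2)] by blast
    then show "travel_time I (place I s) (place I t) \<le> (\<tau> \<circ> g) t - (\<tau> \<circ> g) s"
      using travel * by simp
  next
    fix p assume "p \<in> S"
    then obtain i where i: "i \<in> {1..d}" "p = num i" using request_cases[OF num] by blast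
    then show "pos (p, False) < pos (p, True)" "(\<tau> \<circ> g) (p, False) \<le> (\<tau> \<circ> g) (p, True)"
        "submission I p \<le> (\<tau> \<circ> g) (p, False)" "(\<tau> \<circ> g) (p, False) \<le> submission I p + max_wait I"
      using window[OF i(1)] pickup_first[OF i(1)] by (simp_all add: pos_num)
  next
    fix p assume "p \<in> S \<inter> passengers I"
    then obtain i where i: "i \<in> {1..n}" "p = num i" using request_cases[OF passengers] by blast
    with \<open>n \<le> d\<close> have id: "i \<in> {1..d}" by auto
    show "(\<tau> \<circ> g) (p, True) - earliest_arrival I p \<le> max_delay_passenger I"
      using delay_passenger[OF i(1)] pos_num[OF id] i by simp
    \<comment> \<open>Positions of stops in between lie in an open interval of ranks. Its size is a
      difference of \<open>P\<close> minus one, because the unknown offset \<open>P f\<close>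
      cancels.\<close>
    let ?B = "{s \<in> S \<times> UNIV. pos (p, False) < pos s \<and> pos s < pos (p, True)}"
    have "inj_on pos ?B"
      by (rule inj_on_subset[OF inj_pos]) blast
    then have "card ?B = card (pos ` ?B)" by (simp add: card_image)
    also have "\<dots> \<le> card {rk i<..<rk (d + i)}"
      using id i by (intro card_mono) (auto simp: pos_num)
    also have "\<dots> \<le> max_stops I"
      using stops[OF i(1)] id P_rk[of i] P_rk[of "i + d"] by (simp add: add.commute)
    finally show "card ?B \<le> max_stops I" .
  next
    fix p assume "p \<in> S \<inter> parcels I"
    then obtain i where i: "i \<in> {n+1..d}" "p = num i" using request_cases[OF parcels] by blast
    then have "i \<in> {1..d}" by auto
    then show "(\<tau> \<circ> g) (p, True) - earliest_arrival I p \<le> max_delay_parcel I"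
      using delay_parcel[OF i(1)] pos_num i by simp
  next
    fix s :: "'r \<times> bool"
    assume "s \<in> S \<times> UNIV"
    then obtain j where j: "j \<in> ?V" "s = ?st j" using stop_cases by blast
    have "bij_betw ?st {i \<in> ?V. rk i \<le> rk j} {t \<in> S \<times> UNIV. pos t \<le> rk j}"
    proof (rule bij_betw_imageI)
      show "inj_on ?st {i \<in> ?V. rk i \<le> rk j}"
        by (rule inj_on_subset[OF bij_betw_imp_inj_on[OF st_bij]]) blast
      show "?st ` {i \<in> ?V. rk i \<le> rk j} = {t \<in> S \<times> UNIV. pos t \<le> rk j}"
      proof (intro equalityI subsetI)
        fix t assume "t \<in> ?st ` {i \<in> ?V. rk i \<le> rk j}"
        then obtain i where i: "i \<in> ?V" "rk i \<le> rk j" "t = ?st i" by blast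
        then show "t \<in> {t \<in> S \<times> UNIV. pos t \<le> rk j}" using st_mem[OF i(1)] pos_st[OF i(1)] by simp
      next
        fix t assume t: "t \<in> {t \<in> S \<times> UNIV. pos t \<le> rk j}"
        then obtain i where i: "i \<in> ?V" "t = ?st i" using stop_cases[of t] by blast
        then show "t \<in> ?st ` {i \<in> ?V. rk i \<le> rk j}" using t pos_st[OF i(1)] by simp
      qed
    qed
    note reindex = sum.reindex_bij_betw[OF this, of "load_change I"]
    have "onboard_load I S pos (rk j) =
        (\<Sum>t\<in>{t \<in> S \<times> UNIV. pos t \<le> rk j}. load_change I t)"
      by (rule sum_load_change[OF finS pickup_pos, symmetric])
    also have "\<dots> = (\<Sum>i\<in>{i \<in> ?V. rk i \<le> rk j}. load_change I (?st i))"
      by (rule reindex[symmetric])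
    also have "\<dots> = (\<Sum>i\<in>{i \<in> ?V. rk i \<le> rk j}. stop_load I num d i)"
      by (intro sum.cong) (auto simp: stop_load_eq_load_change)
    also have "\<dots> \<le> w j" by (rule load_sum[OF j(1)])
    finally have "onboard_load I S pos (pos s) \<le> w j" using j by simp
    then show "onboard_load I S pos (pos s) \<le> min (capacity I) (capacity I + load_change I s)"
      using load_bounds[OF j(1)] j by (simp add: stop_load_eq_load_change)
  qed
  then show ?thesis by blast
qed

text \<open>The order determines the schedule: arcs join consecutive ranks, \<open>P\<close> is the
  rank, \<open>w\<close> is the true load, and times at stops are kept. Only the values at the
  depots have to be invented.\<close>

lemma tour_imp_valid_schedule:
  assumes num: "bij_betw num {1..d} S" and S: "S \<subseteq> requests I" "S \<noteq> {}" and "n \<le> d"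
    and passengers: "bij_betw num {1..n} (S \<inter> passengers I)"
    and parcels: "bij_betw num {n+1..d} (S \<inter> parcels I)"
    and tour: "tour I S pos0 \<tau>"
  shows "\<exists>x \<tau> w P. valid_schedule I num n d x \<tau> w P"
proof -
  let ?V = "{1..2 * d}" and ?N = "{0..2 * d + 1}" and ?st = "stop num d"
  have finS: "finite S" using S finite_requests by (blast intro: finite_subset)
  have "card S = d" using bij_betw_same_card[OF num] by simp
  \<comment> \<open>With at least one request, ranks 1 and \<open>2 * d\<close> are taken by stops,
    so the depots are joined to stops and not to each other.\<close>
  with S finS have "d \<ge> 1" by (auto simp: Suc_le_eq card_gt_0_iff)
  obtain pos where pos: "tour I S pos \<tau>" "bij_betw pos (S \<times> UNIV) ?V"
    using tour_normalize[OF tour finS] \<open>card S = d\<close> by blast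
  note t = pos(1)[unfolded tour_def]
  from t have "\<forall>s\<in>S \<times> UNIV. \<forall>t\<in>S \<times> UNIV. pos s < pos t \<longrightarrow>
       travel_time I (place I s) (place I t) \<le> \<tau> t - \<tau> s"
    by (elim conjE)
  then have travel: "\<And>s t. s \<in> S \<times> UNIV \<Longrightarrow> t \<in> S \<times> UNIV \<Longrightarrow> pos s < pos t \<Longrightarrow>
       travel_time I (place I s) (place I t) \<le> \<tau> t - \<tau> s"
    by blast
  from t have "\<forall>p\<in>S. pos (p, False) < pos (p, True) \<and> \<tau> (p, False) \<le> \<tau> (p, True) \<and>
       submission I p \<le> \<tau> (p, False) \<and> \<tau> (p, False) \<le> submission I p + max_wait I"
    by (elim conjE)
  note window = bspec[OF this]
  from t have "\<forall>p\<in>S \<inter> passengers I. \<tau> (p, True) - earliest_arrival I p \<le> max_delay_passenger I"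
    by (elim conjE)
  note delay_passenger = bspec[OF this]
  from t have "\<forall>p\<in>S \<inter> parcels I. \<tau> (p, True) - earliest_arrival I p \<le> max_delay_parcel I"
    by (elim conjE)
  note delay_parcel = bspec[OF this]
  from t have "\<forall>s\<in>S \<times> UNIV.
      onboard_load I S pos (pos s) \<le> min (capacity I) (capacity I + load_change I s)"
    by (elim conjE)
  note onboard_le = bspec[OF this]
  from t have "\<forall>p\<in>S \<inter> passengers I.
       card {s \<in> S \<times> UNIV. pos (p, False) < pos s \<and> pos s < pos (p, True)} \<le> max_stops I"
    by (elim conjE)
  note stops = bspec[OF this]
  note st_bij = bij_betw_stop[OF num]
  have st_mem: "?st i \<in> S \<times> UNIV" if "i \<in> ?V" for i
    using bij_betwE[OF st_bij] that by blast
  have num_mem: "num i \<in> S" if "i \<in> {1..d}" for i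
    using bij_betwE[OF num] that by blast
  have load_nonneg': "0 \<le> load I p" if "p \<in> S" for p using S that load_nonneg by blast

  \<comment> \<open>Depots are ranked 0 and 2 d + 1, so that the arcs driven are those raising the rank by 1.\<close>
  define rk where "rk i = (if i \<in> ?V then pos (?st i) else i)" for i
  have rk_V: "rk i = pos (?st i)" if "i \<in> ?V" for i using that by (simp add: rk_def)
  have rk_0 [simp]: "rk 0 = 0" and rk_end [simp]: "rk (Suc (2 * d)) = Suc (2 * d)"
    by (simp_all add: rk_def)
  have "bij_betw (pos \<circ> ?st) ?V ?V" using bij_betw_trans[OF st_bij pos(2)] .
  then have rk_bij: "bij_betw rk ?V ?V" by (rule bij_betw_cong[THEN iffD1, rotated]) (simp add: rk_V)
  have rk_range: "rk i \<in> ?V" if "i \<in> ?V" for i using bij_betwE[OF rk_bij] that by blast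
  have rk_out: "bij_betw rk (?V \<union> {2 * d + 1}) (?V \<union> {2 * d + 1})"
    by (rule bij_betw_combine[OF rk_bij]) (auto simp: bij_betw_def)
  have rk_in: "bij_betw rk (?V \<union> {0}) (?V \<union> {0})"
    by (rule bij_betw_combine[OF rk_bij]) (auto simp: bij_betw_def)
  have stop_cases: "i \<in> ?V \<or> i = 0 \<or> i = 2 * d + 1" if "i \<in> ?N" for i using that by auto
  define x :: "nat \<Rightarrow> nat \<Rightarrow> nat" where "x i j = (if rk j = Suc (rk i) then 1 else 0)" for i j
  \<comment> \<open>The final depot needs a time no earlier than any stop; the sum of all service
    times is such a bound because they are nonnegative.\<close>
  define \<tau>' where "\<tau>' i =
    (if i = 0 then 0 else if i = 2 * d + 1 then \<Sum>j\<in>?V. \<tau> (?st j) else \<tau> (?st i))" for i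
  define w where "w i = onboard_load I S pos (rk i)" for i
  have \<tau>'_V: "\<tau>' i = \<tau> (?st i)" if "i \<in> ?V" for i using that by (auto simp: \<tau>'_def)
  have \<tau>_nonneg: "0 \<le> \<tau> s" if s: "s \<in> S \<times> UNIV" for s
  proof -
    obtain p b where p: "s = (p, b)" "p \<in> S" using s by auto
    then have "0 \<le> submission I p" using S submission_nonneg by blast
    then show ?thesis using window[OF p(2)] p(1) by (cases b) auto
  qed
  have last: "\<tau> (?st i) \<le> (\<Sum>j\<in>?V. \<tau> (?st j))" if "i \<in> ?V" for i
    using that by (intro member_le_sum[of i ?V "\<lambda>j. \<tau> (?st j)"] \<tau>_nonneg st_mem) auto
  have \<tau>'_nonneg: "0 \<le> \<tau>' i" if "i \<in> ?N" for i
    unfolding \<tau>'_def using stop_cases[OF that] \<tau>_nonneg[OF st_mem] by (auto intro!: sum_nonneg)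
  have pos_bounds: "1 \<le> pos s \<and> pos s \<le> 2 * d" if "s \<in> S \<times> UNIV" for s
    using bij_betwE[OF pos(2)] that by auto
  have w_0: "w 0 = 0" unfolding w_def onboard_load_def
  proof (intro sum.neutral ballI)
    fix p assume "p \<in> S"
    then show "(if pos (p, False) \<le> rk 0 \<and> rk 0 < pos (p, True) then load I p else 0) = 0"
      using pos_bounds[of "(p, False)"] by simp
  qed
  \<comment> \<open>The bound \<open>2 * d\<close> covers both the last stop, which leaves the
    vehicle empty, and the final depot.\<close>
  have w_late: "onboard_load I S pos k = 0" if "2 * d \<le> k" for k unfolding onboard_load_def
  proof (intro sum.neutral ballI)
    fix p assume "p \<in> S"
    then show "(if pos (p, False) \<le> k \<and> k < pos (p, True) then load I p else 0) = 0"
      using pos_bounds[of "(p, True)"] that by simp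
  qed
  have w_nonneg: "0 \<le> w i" for i unfolding w_def using load_nonneg' by (rule onboard_load_nonneg)
  have load_0: "stop_load I num d 0 = 0" and load_end: "stop_load I num d (2 * d + 1) = 0"
    by (simp_all add: stop_load_def)
  have load_V: "stop_load I num d i = load_change I (?st i)" if "i \<in> ?V" for i
    using that by (rule stop_load_eq_load_change)
  have onboard_sum: "onboard_load I S pos k =
      (\<Sum>t\<in>{t \<in> S \<times> UNIV. pos t \<le> k}. load_change I t)" for k
    using window by (subst sum_load_change[OF finS]) auto
  have arc_load: "w j - w i = stop_load I num d j" if "j \<in> ?N" and step: "rk j = Suc (rk i)" for i j
    using stop_cases[OF that(1)]
  proof (elim disjE)
    assume j: "j \<in> ?V"
    \<comment> \<open>As positions are distinct, raising the bound by one admits just the stop of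
      \<open>j\<close>, so the load constraint even holds with equality.\<close>
    have "{t \<in> S \<times> UNIV. pos t \<le> rk j} = insert (?st j) {t \<in> S \<times> UNIV. pos t \<le> rk i}"
    proof -
      have "t = ?st j \<or> pos t \<le> rk i" if t: "t \<in> S \<times> UNIV" "pos t \<le> rk j" for t
      proof -
        have "t = ?st j" if "pos t = pos (?st j)"
          using inj_onD[OF bij_betw_imp_inj_on[OF pos(2)] that t(1) st_mem[OF j]] .
        then show ?thesis using t(2) rk_V[OF j] step by (cases "pos t = rk j") auto
      qed
      moreover have "pos t \<le> rk j" if "pos t \<le> rk i" for t using that step by simp
      moreover have "pos (?st j) \<le> rk j" using rk_V[OF j] by simp
      ultimately show ?thesis using st_mem[OF j] by blast
    qed
    moreover have "?st j \<notin> {t \<in> S \<times> UNIV. pos t \<le> rk i}"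
      using step rk_V[OF j] by simp
    moreover have "finite {t \<in> S \<times> (UNIV :: bool set). pos t \<le> rk i}" using finS by simp
    ultimately show ?thesis by (simp add: w_def onboard_sum load_V[OF j])
  next
    assume "j = 0"
    then show ?thesis using step by simp
  next
    assume j: "j = 2 * d + 1"
    then have "rk j = Suc (2 * d)" by simp
    moreover from this have "rk i = 2 * d" using step by simp
    ultimately have "w j = 0" "w i = 0" by (simp_all add: w_def w_late)
    then show ?thesis using j load_end by simp
  qed
  have arc_time: "stop_travel_time I num d i j \<le> \<tau>' j - \<tau>' i"
    if "i \<in> ?N" "j \<in> ?N" "rk j = Suc (rk i)" for i j
  proof (cases "i \<in> ?V \<and> j \<in> ?V")
    case True
    then show ?thesis
      using travel[OF st_mem st_mem, of i j] that(3) by (simp add: stop_travel_time_eq \<tau>'_V rk_V)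
  next
    case False
    \<comment> \<open>Arcs touching a depot take no time, so it suffices that \<open>\<tau>'\<close>
      does not decrease. No arc leaves the final depot, since its head would need rank
      \<open>2 * d + 2\<close>.\<close>
    then have "stop_travel_time I num d i j = 0" by (auto simp: stop_travel_time_def)
    moreover have "\<tau>' i \<le> \<tau>' j"
    proof (cases "i = 0")
      case True
      then show ?thesis using \<tau>'_nonneg[OF that(2)] by (simp add: \<tau>'_def)
    next
      case False
      have "i \<noteq> 2 * d + 1"
      proof
        assume "i = 2 * d + 1"
        then have "rk j = 2 * d + 2" using that(3) by simp
        then show False using stop_cases[OF that(2)] rk_range[of j] by auto
      qed
      then have "i \<in> ?V" using False stop_cases[OF that(1)] by blast
      moreover have "j \<noteq> 0" using that(3) by (metis rk_0 nat.distinct(1))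
      ultimately have "j = 2 * d + 1" "i \<in> ?V"
        using \<open>\<not> (i \<in> ?V \<and> j \<in> ?V)\<close> stop_cases[OF that(2)] by blast+
      then show ?thesis using last by (simp add: \<tau>'_def)
    qed
    ultimately show ?thesis by simp
  qed
  have bounds: "max 0 (stop_load I num d i) \<le> w i \<and>
      w i \<le> min (capacity I) (capacity I + stop_load I num d i)" if "i \<in> ?N" for i
    using stop_cases[OF that]
  proof (elim disjE)
    assume i: "i \<in> ?V"
    obtain p b where p: "?st i = (p, b)" "p \<in> S" using st_mem[OF i] by auto
    \<comment> \<open>At a delivery the change is at most 0; at a pickup the request itself is on
      board.\<close>
    have "load_change I (?st i) \<le> w i"
    proof (cases b)
      case True
      then show ?thesis
        using w_nonneg[of i] load_nonneg'[OF p(2)] p(1) by (simp add: load_change_def)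
    next
      case False
      then show ?thesis
        using load_le_onboard_load[OF finS load_nonneg' p(2), of pos "rk i"] window[OF p(2)] p(1)
        by (simp add: w_def rk_V[OF i] load_change_def)
    qed
    then show ?thesis
      using onboard_le[OF st_mem[OF i]] w_nonneg[of i] by (simp add: load_V[OF i] w_def rk_V[OF i])
  next
    assume "i = 0"
    then show ?thesis using w_0 load_0 capacity_nonneg by simp
  next
    assume i: "i = 2 * d + 1"
    then have "w i = 0" by (simp add: w_def w_late)
    then show ?thesis using i load_end capacity_nonneg by simp
  qed
  have out_degree: "(\<Sum>j\<in>?V \<union> {2 * d + 1}. x i j) = 1" if "i \<in> ?V" for i
    unfolding x_def using rk_range[OF that] by (intro sum_indicator_bij_betw[OF rk_out]) auto
  have in_degree: "(\<Sum>j\<in>?V \<union> {0}. x j i) = 1" if "i \<in> ?V" for i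
  proof -
    \<comment> \<open>The subtraction is safe because stops have rank at least 1; a stop of rank 1
      is preceded by the depot 0.\<close>
    have "(\<Sum>j\<in>?V \<union> {0}. x j i) = (\<Sum>j\<in>?V \<union> {0}. if rk j = rk i - 1 then 1 else 0)"
      unfolding x_def using rk_range[OF that] by (intro sum.cong) auto
    also have "\<dots> = 1"
      using rk_range[OF that] by (intro sum_indicator_bij_betw[OF rk_in]) auto
    finally show ?thesis .
  qed
  have source: "(\<Sum>i\<in>?V. x 0 i) = 1"
    unfolding x_def using \<open>d \<ge> 1\<close> by (intro sum_indicator_bij_betw[OF rk_bij]) auto
  have sink: "(\<Sum>i\<in>?V. x i (2 * d + 1)) = 1"
  proof -
    have "(\<Sum>i\<in>?V. x i (2 * d + 1)) = (\<Sum>i\<in>?V. if rk i = 2 * d then 1 else 0)"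
      unfolding x_def by (intro sum.cong) auto
    also have "\<dots> = 1"
      using \<open>d \<ge> 1\<close> by (intro sum_indicator_bij_betw[OF rk_bij]) auto
    finally show ?thesis .
  qed
  have stops': "real (rk (i + d)) - real (rk i) - 1 \<le> real (max_stops I)" if i: "i \<in> {1..n}" for i
  proof -
    from \<open>n \<le> d\<close> i have iV: "i \<in> ?V" "i + d \<in> ?V" "i \<in> {1..d}" by auto
    define p where "p = num i"
    have p: "p \<in> S \<inter> passengers I" using bij_betwE[OF passengers] i by (simp add: p_def)
    have rk_p: "rk i = pos (p, False)" "rk (i + d) = pos (p, True)"
      using iV by (simp_all add: rk_V p_def)
    let ?B = "{s \<in> S \<times> UNIV. pos (p, False) < pos s \<and> pos s < pos (p, True)}"
    \<comment> \<open>Here the positions must be without gaps: each rank strictly between pickup and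
      delivery belongs to a stop and is therefore counted.\<close>
    have "{pos (p, False)<..<pos (p, True)} \<subseteq> pos ` ?B"
    proof
      fix k assume k: "k \<in> {pos (p, False)<..<pos (p, True)}"
      then have "k \<in> ?V" using pos_bounds[of "(p, True)"] p by auto
      with bij_betw_imp_surj_on[OF pos(2)] have "k \<in> pos ` (S \<times> UNIV)" by simp
      then obtain s where s: "s \<in> S \<times> UNIV" "pos s = k" by blast
      then have "s \<in> ?B" using k by simp
      then show "k \<in> pos ` ?B" using s(2) by blast
    qed
    then have "card {pos (p, False)<..<pos (p, True)} \<le> card ?B"
      using finS by (intro surj_card_le) auto
    with stops[OF p] have "pos (p, True) - Suc (pos (p, False)) \<le> max_stops I" by simp
    then show ?thesis by (simp add: rk_p)
  qed
  have window': "submission I (num i) \<le> \<tau>' i \<and> \<tau>' i \<le> submission I (num i) + max_wait I \<and>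
      \<tau>' i \<le> \<tau>' (d + i)" if "i \<in> {1..d}" for i
    using window[OF num_mem[OF that]] that by (simp add: \<tau>'_V)
  have delay_passenger': "\<tau>' (d + i) - earliest_arrival I (num i) \<le> max_delay_passenger I"
    if "i \<in> {1..n}" for i
    using delay_passenger[of "num i"] bij_betwE[OF passengers] that \<open>n \<le> d\<close> by (simp add: \<tau>'_V)
  have delay_parcel': "\<tau>' (d + i) - earliest_arrival I (num i) \<le> max_delay_parcel I"
    if "i \<in> {n+1..d}" for i
    using delay_parcel[of "num i"] bij_betwE[OF parcels] that by (simp add: \<tau>'_V)
  have x_rk: "x i j = 1 \<longleftrightarrow> rk j = Suc (rk i)" for i j by (simp add: x_def)
  have "valid_schedule I num n d x \<tau>' w (\<lambda>i. real (rk i))"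
    unfolding valid_schedule_def Let_def
  proof (intro conjI)
    show "\<forall>i\<in>?N. \<forall>j\<in>?N. x i j \<in> {0, 1}" by (simp add: x_def)
    show "\<forall>i\<in>?N. 0 \<le> \<tau>' i \<and> 0 \<le> w i \<and> 0 \<le> real (rk i)"
      using \<tau>'_nonneg w_nonneg by simp
    show "(\<Sum>i\<in>?V. x 0 i) = 1" "(\<Sum>i\<in>?V. x i (2 * d + 1)) = 1"
      by (fact source sink)+
    show "\<forall>i\<in>?V. (\<Sum>j\<in>?V \<union> {2 * d + 1}. x i j) = 1 \<and> (\<Sum>j\<in>?V \<union> {0}. x j i) = 1"
      using out_degree in_degree by blast
    show "\<forall>i\<in>?N. \<forall>j\<in>?N. x i j = 1 \<longrightarrow>
        \<tau>' j - \<tau>' i \<ge> stop_travel_time I num d i j \<and> w j - w i \<ge> stop_load I num d j"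
    proof (intro ballI impI)
      fix i j assume ij: "i \<in> ?N" "j \<in> ?N" "x i j = 1"
      then have "rk j = Suc (rk i)" using x_rk by blast
      then show "\<tau>' j - \<tau>' i \<ge> stop_travel_time I num d i j \<and> w j - w i \<ge> stop_load I num d j"
        using arc_time[OF ij(1,2)] arc_load[OF ij(2)] by simp
    qed
    show "\<forall>i\<in>{1..d}. submission I (num i) \<le> \<tau>' i \<and> \<tau>' i \<le> submission I (num i) + max_wait I \<and>
        \<tau>' i \<le> \<tau>' (d + i)"
      using window' by blast
    show "\<forall>i\<in>{1..n}. \<tau>' (d + i) - earliest_arrival I (num i) \<le> max_delay_passenger I"
      using delay_passenger' by blast
    show "\<forall>i\<in>{n+1..d}. \<tau>' (d + i) - earliest_arrival I (num i) \<le> max_delay_parcel I"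
      using delay_parcel' by blast
    show "\<forall>i\<in>?N. max 0 (stop_load I num d i) \<le> w i \<and>
        w i \<le> min (capacity I) (capacity I + stop_load I num d i)"
      using bounds by blast
    show "\<forall>i\<in>?V. \<forall>j\<in>?V. x i j = 1 \<longrightarrow> real (rk j) = real (rk i) + 1"
      by (simp add: x_def)
    show "\<forall>j\<in>{1..n}. real (rk (j + d)) - real (rk j) - 1 \<le> real (max_stops I)"
      using stops' by blast
    show "\<forall>i\<in>?V. 0 \<le> real (rk i) \<and> real (rk i) \<le> real (2 * d + 1)"
    proof
      fix i assume "i \<in> ?V"
      then have "rk i \<le> 2 * d + 1" using rk_range[of i] by simp
      then show "0 \<le> real (rk i) \<and> real (rk i) \<le> real (2 * d + 1)"
        by (simp only: of_nat_le_iff of_nat_0_le_iff)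
    qed
  qed
  then show ?thesis by blast
qed

text \<open>A tour mentions no numbering, so every numbering that puts passengers first can carry
  its schedule; one is glued together from bijections onto the two kinds of requests.\<close>

lemma feasible_iff_tour:
  assumes S: "S \<subseteq> requests I" "S \<noteq> {}"
  shows "feasible I S \<longleftrightarrow> (\<exists>pos \<tau>. tour I S pos \<tau>)"
proof -
  define n d where "n = card (S \<inter> passengers I)" and "d = n + card (S \<inter> parcels I)"
  then have "n \<le> d" by simp
  have "finite S" using S finite_requests by (blast intro: finite_subset)
  have split: "S = (S \<inter> passengers I) \<union> (S \<inter> parcels I)"
    using S by (auto simp: requests_def)
  have disj: "(S \<inter> passengers I) \<inter> (S \<inter> parcels I) = {}" using disjoint_requests by auto
  have ivl: "{1..d} = {1..n} \<union> {n+1..d}" by (auto simp: d_def)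
  have num_bij: "bij_betw num {1..d} S"
    if "bij_betw num {1..n} (S \<inter> passengers I)" "bij_betw num {n+1..d} (S \<inter> parcels I)" for num
    using bij_betw_combine[OF that disj] split ivl by simp
  have feasible_iff: "feasible I S \<longleftrightarrow> (\<exists>num. bij_betw num {1..n} (S \<inter> passengers I) \<and>
      bij_betw num {n+1..d} (S \<inter> parcels I) \<and> (\<exists>x \<tau> w P. valid_schedule I num n d x \<tau> w P))"
    by (simp add: feasible_def Let_def n_def d_def)
  show ?thesis
  proof
    assume "feasible I S"
    then obtain num x \<tau> w P where num: "bij_betw num {1..n} (S \<inter> passengers I)"
        "bij_betw num {n+1..d} (S \<inter> parcels I)" and "valid_schedule I num n d x \<tau> w P"
      unfolding feasible_iff by blast
    then show "\<exists>pos \<tau>. tour I S pos \<tau>"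
      using valid_schedule_imp_tour[OF num_bij[OF num] S(1) _ num] \<open>n \<le> d\<close> by blast
  next
    assume "\<exists>pos \<tau>. tour I S pos \<tau>"
    then obtain pos \<tau> where tour: "tour I S pos \<tau>" by blast
    obtain f where f: "bij_betw f {1..n} (S \<inter> passengers I)"
      using \<open>finite S\<close> finite_same_card_bij[of "{1..n}" "S \<inter> passengers I"] by (auto simp: n_def)
    obtain g where g: "bij_betw g {n+1..d} (S \<inter> parcels I)"
      using \<open>finite S\<close> finite_same_card_bij[of "{n+1..d}" "S \<inter> parcels I"] by (auto simp: d_def)
    define num where "num i = (if i \<le> n then f i else g i)" for i
    have "bij_betw num {1..n} (S \<inter> passengers I)"
      using f by (rule bij_betw_cong[THEN iffD1, rotated]) (simp add: num_def)
    moreover have "bij_betw num {n+1..d} (S \<inter> parcels I)"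
      using g by (rule bij_betw_cong[THEN iffD1, rotated]) (simp add: num_def)
    moreover note tour_imp_valid_schedule[OF num_bij[OF calculation] S \<open>n \<le> d\<close> calculation tour]
    ultimately show "feasible I S"
      unfolding feasible_iff by blast
  qed
qed

section \<open>Subset closure and the recursion on the size of trips\<close>

lemma trips_subset_closed:
  assumes "S \<in> trips I" "S' \<subseteq> S" "S' \<noteq> {}"
  shows "S' \<in> trips I"
proof -
  have S: "S \<subseteq> requests I" "S \<noteq> {}" "feasible I S" using assms(1) by (auto simp: trips_def)
  then obtain pos \<tau> where "tour I S pos \<tau>" using feasible_iff_tour by blast
  moreover have "finite S" using S(1) finite_requests by (rule finite_subset)
  ultimately have "tour I S' pos \<tau>"
    using tour_subset[OF _ assms(2)] S(1) load_nonneg by blast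
  then show ?thesis
    using feasible_iff_tour[of S'] S(1) assms(2,3) by (auto simp: trips_def)
qed

end

theorem lemma4p2:
  fixes I :: "('v, 'a, 'r) scenario" and r :: "nat \<Rightarrow> 'r" and l :: nat
  assumes "ride_sharing_scenario I"
    and "bij_betw r {1..card (requests I)} (requests I)"
    and "l \<ge> 1"
  shows "trips_of_size I (l + 1) =
    (\<Union>p\<in>trips_of_size I l.
       {p \<union> {r j} | j. max_index I r p + 1 \<le> j \<and> j \<le> card (requests I)}) \<inter> trips I"
    (is "?L = ?R")
proof -
  interpret ride_sharing_scenario I by fact
  define J where "J p = {j. 1 \<le> j \<and> j \<le> card (requests I) \<and> r j \<in> p}" for p
  have finJ: "finite (J p)" for p
    by (rule finite_subset[of _ "{..card (requests I)}"]) (auto simp: J_def)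
  have max_index: "max_index I r p = Max (J p)" for p by (simp add: max_index_def J_def)
  \<comment> \<open>\<open>Max\<close> is meaningful only on nonempty sets; a trip contains a
    request, and every request has an index.\<close>
  have J_nonempty: "J p \<noteq> {}" if p: "p \<in> trips I" for p
  proof -
    obtain a where "a \<in> p" "a \<in> requests I" using p by (auto simp: trips_def)
    then obtain j where "j \<in> {1..card (requests I)}" "a = r j"
      using bij_betw_imp_surj_on[OF assms(2)] by blast
    then show ?thesis using \<open>a \<in> p\<close> by (auto simp: J_def)
  qed
  have fin: "finite p" if "p \<in> trips I" for p
    using that finite_requests by (auto simp: trips_def intro: finite_subset)
  show ?thesis
  proof (intro equalityI subsetI)
    fix S assume "S \<in> ?L"
    then have S: "S \<in> trips I" "card S = l + 1" by (auto simp: trips_of_size_def)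
    define j where "j = Max (J S)"
    have j: "j \<in> J S" using Max_in[OF finJ J_nonempty[OF S(1)]] by (simp add: j_def)
    define p where "p = S - {r j}"
    have card_p: "card p = l" using j S by (simp add: p_def J_def)
    \<comment> \<open>This is where \<open>l \<ge> 1\<close> enters: the empty set is not a
      trip.\<close>
    with assms(3) have "p \<noteq> {}" by auto
    then have p: "p \<in> trips I"
      by (intro trips_subset_closed[OF S(1)]) (auto simp: p_def)
    have "Max (J p) \<in> J p" by (rule Max_in[OF finJ J_nonempty[OF p]])
    \<comment> \<open>Removing \<open>r j\<close> removes the index \<open>j\<close>, the maximum
      for \<open>S\<close>, so the maximum for \<open>p\<close> is strictly smaller.\<close>
    moreover have "J p \<subseteq> J S - {j}" by (auto simp: J_def p_def)
    ultimately have "Max (J p) \<le> j" "Max (J p) \<noteq> j"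
      using Max_ge[OF finJ] by (auto simp: j_def)
    then have "max_index I r p + 1 \<le> j" by (simp add: max_index)
    moreover have "S = p \<union> {r j}" "j \<le> card (requests I)" using j by (auto simp: p_def J_def)
    ultimately show "S \<in> ?R"
      using p card_p S(1) by (auto simp: trips_of_size_def)
  next
    fix S assume "S \<in> ?R"
    then obtain p j where p: "p \<in> trips I" "card p = l" and S: "S \<in> trips I" "S = p \<union> {r j}"
      and j: "max_index I r p + 1 \<le> j" "j \<le> card (requests I)"
      by (auto simp: trips_of_size_def)
    \<comment> \<open>An index above the maximum is new, so adding \<open>r j\<close> raises the
      cardinality by exactly one; feasibility comes from the intersection with
      \<open>trips I\<close>.\<close>
    have "j \<notin> J p" using Max_ge[OF finJ, of j p] j(1) by (auto simp: max_index)
    then have "r j \<notin> p" using j by (auto simp: J_def)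
    then show "S \<in> ?L" using p S fin[OF p(1)] by (simp add: trips_of_size_def)
  qed
qed

end
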